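(* For every integer $n\ge 2$, $$\#\{m\in G(I_n):|\operatorname{supp}(m)|=2\}\ \ge\ \binom{\pi(n)}{2},$$ with equality exactly for $2\le n\le 8$.
   Context: $p_1=2<p_2=3<\cdots$ are the primes and $\pi(x)$ is the number of primes $\le x$. $K$ is a field containing $\mathbb{Q}$. For a positive integer $n$ put $r=\pi(n)$ and $S=K[x_1,\dots,x_r]$. The weight of a monomial $m=x_1^{a_1}\cdots x_r^{a_r}$ is $w(m)=\prod_i p_i^{a_i}$, and its support is $\operatorname{supp}(m)=\{i:a_i>0\}$. $I_n\subset S$ is the monomial ideal generated by all monomials of weight $>n$, and $G(I_n)$ is its minimal monomial generating set. *)

theory Defs
  imports
    "HOL-Library.Infinite_Set"
    "HOL-Library.Poly_Mapping"
    "HOL-Computational_Algebra.Primes"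
    "HOL-Algebra.Ideal"
begin

definition prime_pi :: "nat \<Rightarrow> nat" where
  "prime_pi x = card {p. prime p \<and> p \<le> x}"

(* Numbered from 1, so nth_prime 1 = 2. The value at 0 is irrelevant. *)
definition nth_prime :: "nat \<Rightarrow> nat" where
  "nth_prime i = enumerate {p. prime p} (i - 1)"

(* A monomial is its exponent vector a, where Poly_Mapping.lookup a i is the exponent of x_i and
   Poly_Mapping.keys a its support. A polynomial sends each monomial to its coefficient. *)
type_synonym monomial = "nat \<Rightarrow>\<^sub>0 nat"
type_synonym 'k mpoly = "monomial \<Rightarrow>\<^sub>0 'k"

definition monomials :: "nat \<Rightarrow> monomial set" where
  "monomials r = {a. Poly_Mapping.keys a \<subseteq> {1..r}}"

definition weight :: "monomial \<Rightarrow> nat" where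
  "weight a = (\<Prod>i\<in>Poly_Mapping.keys a. nth_prime i ^ Poly_Mapping.lookup a i)"

(* K[x_1, ..., x_r], with K the type 'k *)
definition polynomial_ring :: "nat \<Rightarrow> 'k::field mpoly ring" where
  "polynomial_ring r =
     \<lparr>carrier = {f. Poly_Mapping.keys f \<subseteq> monomials r},
      monoid.mult = (*), one = 1, zero = 0, add = (+)\<rparr>"

definition mono_ideal :: "nat \<Rightarrow> monomial set \<Rightarrow> 'k::field mpoly set" where
  "mono_ideal r A = genideal (polynomial_ring r) ((\<lambda>a. Poly_Mapping.single a 1) ` A)"

definition weight_ideal :: "nat \<Rightarrow> 'k::field mpoly set" where
  "weight_ideal n = mono_ideal (prime_pi n) {a \<in> monomials (prime_pi n). weight a > n}"

definition is_minimal_mono_gens :: "nat \<Rightarrow> 'k::field mpoly set \<Rightarrow> monomial set \<Rightarrow> bool" where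
  "is_minimal_mono_gens r I A \<longleftrightarrow>
     A \<subseteq> monomials r \<and> mono_ideal r A = I \<and> (\<forall>B. B \<subset> A \<longrightarrow> mono_ideal r B \<noteq> I)"

definition minimal_mono_gens :: "nat \<Rightarrow> 'k::field mpoly set \<Rightarrow> monomial set" where
  "minimal_mono_gens r I = (THE A. is_minimal_mono_gens r I A)"

lemma single_one_in_carrier:
  "a \<in> monomials r \<Longrightarrow> Poly_Mapping.single a 1 \<in> carrier (polynomial_ring r :: 'k::field mpoly ring)"
  by (auto simp: polynomial_ring_def)

lemma monomials_add: "a \<in> monomials r \<Longrightarrow> b \<in> monomials r \<Longrightarrow> a + b \<in> monomials r"
  using Poly_Mapping.keys_add[of a b] by (auto simp: monomials_def)

lemma cring_polynomial_ring: "cring (polynomial_ring r :: 'k::field mpoly ring)"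
proof (rule cringI)
  show "abelian_group (polynomial_ring r :: 'k mpoly ring)"
  proof (rule abelian_groupI)
    fix f :: "'k mpoly" assume "f \<in> carrier (polynomial_ring r)"
    then have "- f \<in> carrier (polynomial_ring r)"
      by (auto simp: polynomial_ring_def in_keys_iff subset_iff)
    then show "\<exists>g\<in>carrier (polynomial_ring r). g \<oplus>\<^bsub>polynomial_ring r\<^esub> f = \<zero>\<^bsub>polynomial_ring r\<^esub>"
      by (intro bexI[of _ "- f"]) (simp_all add: polynomial_ring_def)
  next
    fix f g :: "'k mpoly" assume "f \<in> carrier (polynomial_ring r)" "g \<in> carrier (polynomial_ring r)"
    then show "f \<oplus>\<^bsub>polynomial_ring r\<^esub> g \<in> carrier (polynomial_ring r)"
      using Poly_Mapping.keys_add[of f g] by (auto simp: polynomial_ring_def)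
  qed (auto simp: polynomial_ring_def algebra_simps)
  show "comm_monoid (polynomial_ring r :: 'k mpoly ring)"
  proof (rule comm_monoidI)
    fix f g :: "'k mpoly" assume *: "f \<in> carrier (polynomial_ring r)" "g \<in> carrier (polynomial_ring r)"
    show "f \<otimes>\<^bsub>polynomial_ring r\<^esub> g \<in> carrier (polynomial_ring r)"
    proof -
      have "Poly_Mapping.keys (f * g) \<subseteq> monomials r"
      proof
        fix c assume "c \<in> Poly_Mapping.keys (f * g)"
        then obtain a b where "c = a + b" "a \<in> Poly_Mapping.keys f" "b \<in> Poly_Mapping.keys g"
          using Poly_Mapping.keys_mult[of f g] by blast
        then show "c \<in> monomials r"
          using * by (auto simp: polynomial_ring_def intro!: monomials_add)
      qed
      then show ?thesis by (simp add: polynomial_ring_def)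
    qed
  qed (auto simp: polynomial_ring_def monomials_def algebra_simps)
qed (auto simp: polynomial_ring_def algebra_simps)

lemma single_add_mult:
  fixes x :: "'k::field"
  shows "Poly_Mapping.single (a + b) x = Poly_Mapping.single b x * (Poly_Mapping.single a 1 :: 'k mpoly)"
  by (simp add: mult_single add.commute)

lemma poly_eq_sum_single:
  fixes f :: "'k::field mpoly"
  shows "f = (\<Sum>c\<in>Poly_Mapping.keys f. Poly_Mapping.single c (Poly_Mapping.lookup f c))"
proof (rule poly_mapping_eqI)
  fix k
  have "(\<Sum>c\<in>Poly_Mapping.keys f. Poly_Mapping.lookup (Poly_Mapping.single c (Poly_Mapping.lookup f c)) k)
      = (\<Sum>c\<in>Poly_Mapping.keys f. if c = k then Poly_Mapping.lookup f c else 0)"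
    by (rule sum.cong) (simp_all add: lookup_single when_def)
  also have "\<dots> = Poly_Mapping.lookup f k"
    by (simp add: in_keys_iff)
  finally show "Poly_Mapping.lookup f k =
      Poly_Mapping.lookup (\<Sum>c\<in>Poly_Mapping.keys f. Poly_Mapping.single c (Poly_Mapping.lookup f c)) k"
    by (simp add: lookup_sum)
qed

definition multiples :: "nat \<Rightarrow> monomial set \<Rightarrow> monomial set" where
  "multiples r A = {a + b |a b. a \<in> A \<and> b \<in> monomials r}"

lemma multiples_self:
  assumes "a \<in> A" shows "a \<in> multiples r A"
proof -
  have "a = a + 0" "0 \<in> monomials r" by (simp_all add: monomials_def)
  then show ?thesis using assms unfolding multiples_def by blast
qed

lemma multiples_add:
  assumes "c \<in> multiples r A" "b \<in> monomials r" shows "c + b \<in> multiples r A"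
proof -
  obtain a d where ad: "c = a + d" "a \<in> A" "d \<in> monomials r"
    using assms by (auto simp: multiples_def)
  then have "c + b = a + (d + b)" by (simp add: add.assoc)
  then show ?thesis using ad monomials_add[OF ad(3) assms(2)] unfolding multiples_def by blast
qed

lemma mono_ideal_eq:
  assumes A: "A \<subseteq> monomials r"
  shows "(mono_ideal r A :: 'k::field mpoly set) = {f. Poly_Mapping.keys f \<subseteq> multiples r A}"
    (is "?I = ?J")
proof
  let ?R = "polynomial_ring r :: 'k mpoly ring"
  let ?G = "(\<lambda>a. Poly_Mapping.single a 1 :: 'k mpoly) ` A"
  interpret cring ?R by (rule cring_polynomial_ring)
  have G: "?G \<subseteq> carrier ?R" using A by (auto simp: polynomial_ring_def)
  have mult_car: "multiples r A \<subseteq> monomials r"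
    using A by (auto simp: multiples_def intro!: monomials_add)
  have neg: "\<ominus>\<^bsub>?R\<^esub> f = - f" if "f \<in> carrier ?R" for f
    using that by (intro minus_equality) (auto simp: polynomial_ring_def in_keys_iff subset_iff)
  have idJ: "ideal ?J ?R"
  proof (rule idealI)
    show "ring ?R" by (rule ring_axioms)
    show "subgroup ?J (add_monoid ?R)"
    proof (rule add.subgroupI)
      show "?J \<subseteq> carrier ?R" using mult_car by (auto simp: polynomial_ring_def)
      show "?J \<noteq> {}" by (auto intro!: exI[of _ 0])
    next
      fix f assume f: "f \<in> ?J"
      then have "f \<in> carrier ?R" using mult_car by (auto simp: polynomial_ring_def)
      then show "\<ominus>\<^bsub>?R\<^esub> f \<in> ?J" using f by (auto simp: neg in_keys_iff subset_iff)
    next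
      fix f g assume "f \<in> ?J" "g \<in> ?J"
      then show "f \<oplus>\<^bsub>?R\<^esub> g \<in> ?J"
        using Poly_Mapping.keys_add[of f g] by (auto simp: polynomial_ring_def)
    qed
  next
    fix f g assume "f \<in> ?J" "g \<in> carrier ?R"
    then have "Poly_Mapping.keys (f * g) \<subseteq> multiples r A"
      using Poly_Mapping.keys_mult[of f g] by (fastforce simp: polynomial_ring_def intro: multiples_add)
    then show "g \<otimes>\<^bsub>?R\<^esub> f \<in> ?J" "f \<otimes>\<^bsub>?R\<^esub> g \<in> ?J"
      by (simp_all add: polynomial_ring_def mult.commute)
  qed
  have "?G \<subseteq> ?J"
  proof clarify
    fix a c assume "a \<in> A" "c \<in> Poly_Mapping.keys (Poly_Mapping.single a 1 :: 'k mpoly)"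
    then show "c \<in> multiples r A" by (simp add: multiples_self)
  qed
  then show "?I \<subseteq> ?J" unfolding mono_ideal_def by (rule genideal_minimal[OF idJ])
  interpret I: ideal ?I ?R unfolding mono_ideal_def by (rule genideal_ideal[OF G])
  have zero: "0 \<in> ?I" using I.zero_closed by (simp add: polynomial_ring_def)
  have add: "f + g \<in> ?I" if "f \<in> ?I" "g \<in> ?I" for f g
    using I.a_closed[OF that] by (simp add: polynomial_ring_def)
  have single: "Poly_Mapping.single c x \<in> ?I" if c: "c \<in> multiples r A" for c x
  proof -
    obtain a b where ab: "c = a + b" "a \<in> A" "b \<in> monomials r"
      using c by (auto simp: multiples_def)
    have "Poly_Mapping.single a 1 \<in> ?I"
      unfolding mono_ideal_def using genideal_self[OF G] ab by blast
    moreover have "Poly_Mapping.single b x \<in> carrier ?R"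
      using ab by (auto simp: polynomial_ring_def)
    ultimately have "Poly_Mapping.single b x \<otimes>\<^bsub>?R\<^esub> Poly_Mapping.single a 1 \<in> ?I"
      by (rule I.I_l_closed)
    then show ?thesis
      by (simp add: ab(1) single_add_mult polynomial_ring_def)
  qed
  show "?J \<subseteq> ?I"
  proof
    fix f assume f: "f \<in> ?J"
    have "(\<Sum>c\<in>B. Poly_Mapping.single c (Poly_Mapping.lookup f c)) \<in> ?I"
      if "finite B" "B \<subseteq> multiples r A" for B
      using that by (induction B rule: finite_induct) (auto intro: zero add single)
    then show "f \<in> ?I" using f by (subst poly_eq_sum_single[of f]) auto
  qed
qed

lemma mono_ideal_eq_iff:
  assumes "A \<subseteq> monomials r" "B \<subseteq> monomials r"
  shows "(mono_ideal r A :: 'k::field mpoly set) = mono_ideal r B \<longleftrightarrow> multiples r A = multiples r B"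
proof
  assume eq: "(mono_ideal r A :: 'k mpoly set) = mono_ideal r B"
  have "c \<in> multiples r A \<longleftrightarrow> c \<in> multiples r B" for c
  proof -
    have "(Poly_Mapping.single c 1 :: 'k mpoly) \<in> mono_ideal r A \<longleftrightarrow>
          (Poly_Mapping.single c 1 :: 'k mpoly) \<in> mono_ideal r B"
      by (simp add: eq)
    then show ?thesis by (simp add: mono_ideal_eq assms)
  qed
  then show "multiples r A = multiples r B" by blast
qed (simp add: mono_ideal_eq assms)

(* So THE in minimal_mono_gens denotes whenever I is generated by monomials. *)
lemma ex1_minimal_mono_gens:
  assumes A: "A \<subseteq> monomials r"
  shows "\<exists>!B. is_minimal_mono_gens r (mono_ideal r A :: 'k::field mpoly set) B"
proof -
  define deg where "deg a = (\<Sum>i\<in>{1..r}. Poly_Mapping.lookup a i)" for a :: monomial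
  have deg_add: "deg (a + b) = deg a + deg b" for a b
    by (simp add: deg_def lookup_add sum.distrib)
  have deg_0: "b = 0" if "deg b = 0" "b \<in> monomials r" for b
  proof (rule poly_mapping_eqI)
    fix i show "Poly_Mapping.lookup b i = Poly_Mapping.lookup 0 i"
    proof (cases "i \<in> {1..r}")
      case True
      then show ?thesis using that(1) by (simp add: deg_def)
    next
      case False
      then have "i \<notin> Poly_Mapping.keys b" using that(2) by (auto simp: monomials_def)
      then show ?thesis by (simp add: in_keys_iff)
    qed
  qed
  have mono_mult: "multiples r B \<subseteq> multiples r C" if "B \<subseteq> multiples r C" for B C
  proof
    fix c assume "c \<in> multiples r B"
    then obtain a b where "c = a + b" "a \<in> B" "b \<in> monomials r"
      by (auto simp: multiples_def)
    then show "c \<in> multiples r C" using that multiples_add by blast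
  qed
  define M where "M = {a \<in> A. \<forall>a'\<in>A. \<forall>b\<in>monomials r. a = a' + b \<longrightarrow> b = 0}"
  have M_A: "M \<subseteq> A" by (auto simp: M_def)
  have "a \<in> multiples r M" if "a \<in> A" for a
    using that
  proof (induction "deg a" arbitrary: a rule: less_induct)
    case less
    show ?case
    proof (cases "a \<in> M")
      case False
      then obtain a' b where ab: "a' \<in> A" "b \<in> monomials r" "a = a' + b" "b \<noteq> 0"
        using less.prems by (auto simp: M_def)
      then have "deg a' < deg a" using deg_0[of b] by (auto simp: deg_add)
      then show ?thesis using less.hyps ab multiples_add by blast
    qed (rule multiples_self)
  qed
  then have mM: "multiples r M = multiples r A"
    using mono_mult[of A M] mono_mult[of M A] M_A multiples_self by blast
  have M_sub: "M \<subseteq> B" if B: "multiples r B = multiples r A" "B \<subseteq> monomials r" for B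
  proof
    fix m assume m: "m \<in> M"
    then have "m \<in> multiples r B" using B multiples_self M_A by blast
    then obtain b c where bc: "m = b + c" "b \<in> B" "c \<in> monomials r"
      by (auto simp: multiples_def)
    have "b \<in> multiples r A" using bc multiples_self B by blast
    then obtain a d where ad: "b = a + d" "a \<in> A" "d \<in> monomials r"
      by (auto simp: multiples_def)
    have "m = a + (d + c)" using bc ad by (simp add: add.assoc)
    then have "d + c = 0" using m ad bc monomials_add[of d r c] by (auto simp: M_def)
    then have "deg c = 0" using deg_add[of d c] by (simp add: deg_def)
    then have "c = 0" using deg_0 bc by blast
    then show "m \<in> B" using bc by simp
  qed
  show ?thesis
  proof (rule ex1I[of _ M])
    have "multiples r B \<noteq> multiples r A" if "B \<subset> M" for B
      using M_sub[of B] that M_A A by blast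
    then show "is_minimal_mono_gens r (mono_ideal r A :: 'k mpoly set) M"
      unfolding is_minimal_mono_gens_def
      using M_A A mM by (auto simp: mono_ideal_eq_iff)
  next
    fix B assume B: "is_minimal_mono_gens r (mono_ideal r A :: 'k mpoly set) B"
    have B1: "B \<subseteq> monomials r" "multiples r B = multiples r A"
      using B A by (auto simp: is_minimal_mono_gens_def mono_ideal_eq_iff)
    then have "M \<subseteq> B" using M_sub by blast
    moreover have "\<not> M \<subset> B"
    proof
      assume "M \<subset> B"
      then have "(mono_ideal r M :: 'k mpoly set) \<noteq> mono_ideal r A"
        using B unfolding is_minimal_mono_gens_def by (elim conjE allE impE)
      then show False using mM mono_ideal_eq_iff[where 'k = 'k, OF subset_trans[OF M_A A] A] by simp
    qed
    ultimately show "B = M" by blast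
  qed
qed

end

theory Submission
  imports Defs
begin

text \<open>
  A monomial of weight \<open>w > n\<close> is a minimal generator iff \<open>w \<le> n p\<^sub>i\<close> for every \<open>i\<close> in its support.
  For \<open>p\<^sub>i < p\<^sub>j \<le> n\<close> the monomial \<open>x\<^sub>i\<^sup>a x\<^sub>j\<^sup>b\<close> is therefore a minimal generator iff \<open>a\<close> is the least
  exponent with \<open>p\<^sub>i\<^sup>a p\<^sub>j\<^sup>b > n\<close>, and this \<open>a\<close> is positive iff \<open>p\<^sub>j\<^sup>b \<le> n\<close>. So the generators with
  support of size two correspond to the triples \<open>(i, j, b)\<close> with \<open>i < j\<close>, \<open>b \<ge> 1\<close>, \<open>p\<^sub>j\<^sup>b \<le> n\<close>.
  The triples with \<open>b = 1\<close> are as many as the pairs \<open>i < j\<close>, and there are others iff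
  \<open>p\<^sub>2\<^sup>2 = 9 \<le> n\<close>.
\<close>

section \<open>The primes in increasing order\<close>

lemma prime_nth_prime: "prime (nth_prime i)"
  using enumerate_in_set[OF primes_infinite, of "i - 1"] by (simp add: nth_prime_def)

lemma nth_prime_gt_1: "1 < nth_prime i"
  using prime_nth_prime prime_gt_1_nat by blast

lemma nth_prime_strict_mono: "1 \<le> i \<Longrightarrow> i < j \<Longrightarrow> nth_prime i < nth_prime j"
  unfolding nth_prime_def using primes_infinite by (intro enumerate_mono) auto

text \<open>If \<open>nth_prime j\<close> exceeded \<open>n\<close>, every prime up to
  \<open>n\<close> would be one of the \<open>j - 1\<close> primes before it, whose positions in
  \<open>enumerate\<close> are \<open>0, ..., j - 2\<close>.\<close>

lemma nth_prime_le:
  assumes "1 \<le> j" "j \<le> prime_pi n"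
  shows "nth_prime j \<le> n"
proof (rule ccontr)
  assume gt: "\<not> nth_prime j \<le> n"
  have "{p. prime p \<and> p \<le> n} \<subseteq> enumerate {p. prime p} ` {..<j - 1}"
  proof clarify
    fix p :: nat assume p: "prime p" "p \<le> n"
    then obtain k where k: "p = enumerate {p. prime p} k"
      using enumerate_Ex[OF primes_infinite, of p] by auto
    have "k < j - 1"
    proof (rule ccontr)
      assume "\<not> k < j - 1"
      then have "nth_prime j \<le> p"
        unfolding k nth_prime_def using primes_infinite by (intro enumerate_mono_le_iff[THEN iffD2]) auto
      then show False using gt p by simp
    qed
    then show "p \<in> enumerate {p. prime p} ` {..<j - 1}" using k by blast
  qed
  then have "prime_pi n \<le> j - 1"
    unfolding prime_pi_def using surj_card_le[of "{..<j - 1}"] by simp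
  then show False using assms by simp
qed

lemma nth_prime_2: "nth_prime 2 = 3"
proof (rule antisym)
  obtain k where k: "3 = enumerate {p :: nat. prime p} k"
    using enumerate_Ex[OF primes_infinite, of 3] by auto
  \<comment> \<open>The first prime is at most 2, so 3 sits at position 1 or later, and position 1
    is where \<open>nth_prime 2\<close> is read off.\<close>
  have "enumerate {p :: nat. prime p} 0 \<le> 2"
    unfolding enumerate_0 by (rule Least_le) simp
  then have "k \<noteq> 0" using k by (intro notI) simp
  then show "nth_prime 2 \<le> 3"
    unfolding k nth_prime_def using primes_infinite by (intro enumerate_mono_le_iff[THEN iffD2]) auto
  show "3 \<le> nth_prime 2"
    using nth_prime_strict_mono[of 1 2] nth_prime_gt_1[of 1] by simp
qed

lemma nth_prime_ge_3: "2 \<le> j \<Longrightarrow> 3 \<le> nth_prime j"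
  using nth_prime_strict_mono[of 2 j] nth_prime_2 by (cases "j = 2") auto

section \<open>Weights of products of monomials\<close>

text \<open>Indices outside the support contribute factors with exponent 0, so weights of different
  monomials can be compared over one index set.\<close>

lemma weight_eq_prod:
  assumes "finite I" "Poly_Mapping.keys a \<subseteq> I"
  shows "weight a = (\<Prod>i\<in>I. nth_prime i ^ Poly_Mapping.lookup a i)"
  unfolding weight_def using assms by (intro prod.mono_neutral_left) (auto simp: in_keys_iff)

lemma weight_add: "weight (a + b) = weight a * weight b"
proof -
  let ?I = "Poly_Mapping.keys a \<union> Poly_Mapping.keys b"
  have "weight c = (\<Prod>i\<in>?I. nth_prime i ^ Poly_Mapping.lookup c i)" if "c \<in> {a, b, a + b}" for c
    using that Poly_Mapping.keys_add[of a b] by (intro weight_eq_prod) auto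
  then show ?thesis by (simp add: lookup_add power_add prod.distrib)
qed

lemma weight_single: "weight (Poly_Mapping.single i k) = nth_prime i ^ k"
  by (subst weight_eq_prod[of "{i}"]) auto

lemma weight_pos: "0 < weight a"
  unfolding weight_def using nth_prime_gt_1 by (intro prod_pos) (auto intro: less_trans[of 0 1])

lemma split_key:
  fixes a :: monomial
  assumes "i \<in> Poly_Mapping.keys a"
  obtains a' where "a = a' + Poly_Mapping.single i 1" "Poly_Mapping.keys a' \<subseteq> Poly_Mapping.keys a"
proof
  \<comment> \<open>Subtraction of exponents truncates at 0; it is exact here because
    \<open>i\<close> lies in the support of \<open>a\<close>.\<close>
  let ?a' = "a - Poly_Mapping.single i 1"
  show "a = ?a' + Poly_Mapping.single i 1"
    using assms by (intro poly_mapping_eqI) (auto simp: lookup_add lookup_minus lookup_single in_keys_iff when_def)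
  show "Poly_Mapping.keys ?a' \<subseteq> Poly_Mapping.keys a"
    by (auto simp: in_keys_iff lookup_minus)
qed

lemma nth_prime_le_weight:
  assumes "i \<in> Poly_Mapping.keys a"
  shows "nth_prime i \<le> weight a"
  using assms
proof (rule split_key)
  fix a' assume "a = a' + Poly_Mapping.single i 1"
  then show ?thesis using weight_pos[of a'] by (simp add: weight_add weight_single)
qed

section \<open>Minimal generators of the weight ideal\<close>

text \<open>The last condition says, without division, that dividing by any variable of the support
  brings the weight down to at most \<open>n\<close>.\<close>

definition min_gens :: "nat \<Rightarrow> nat \<Rightarrow> monomial set" where
  "min_gens r n =
     {a \<in> monomials r. n < weight a \<and> (\<forall>i\<in>Poly_Mapping.keys a. weight a \<le> n * nth_prime i)}"

text \<open>Induction on the weight: a monomial violating the condition at \<open>i\<close> can be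
  divided by the \<open>i\<close>-th variable and still has weight above \<open>n\<close>.\<close>

lemma multiples_min_gens:
  assumes "a \<in> monomials r" "n < weight a"
  shows "a \<in> multiples r (min_gens r n)"
  using assms
proof (induction "weight a" arbitrary: a rule: less_induct)
  case less
  show ?case
  proof (cases "a \<in> min_gens r n")
    case False
    then obtain i where i: "i \<in> Poly_Mapping.keys a" "n * nth_prime i < weight a"
      using less.prems by (auto simp: min_gens_def not_le)
    obtain a' where a': "a = a' + Poly_Mapping.single i 1" "Poly_Mapping.keys a' \<subseteq> Poly_Mapping.keys a"
      using i(1) by (rule split_key)
    have w: "weight a = weight a' * nth_prime i" by (simp add: a'(1) weight_add weight_single)
    have "a' \<in> monomials r" using a' less.prems by (auto simp: monomials_def)
    moreover have "weight a' < weight a" using w weight_pos[of a'] nth_prime_gt_1[of i] by simp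
    moreover have "n < weight a'" using i(2) w by simp
    ultimately have "a' \<in> multiples r (min_gens r n)" using less.hyps by blast
    moreover have "Poly_Mapping.single i 1 \<in> monomials r"
      using i less.prems by (auto simp: monomials_def)
    ultimately show ?thesis unfolding a'(1) by (rule multiples_add)
  qed (rule multiples_self)
qed

text \<open>A nontrivial \<open>d\<close> contains some variable \<open>i\<close>, so
  \<open>weight d\<close> is at least \<open>nth_prime i\<close>; the condition at \<open>i\<close>
  then forces \<open>weight c \<le> n\<close>. Hence no proper divisor of a generator has weight
  above \<open>n\<close>.\<close>

lemma min_gens_dvd:
  assumes "c + d \<in> min_gens r n" "n < weight c"
  shows "d = 0"
proof (rule ccontr)
  assume "d \<noteq> 0"
  then obtain i where i: "i \<in> Poly_Mapping.keys d" by (auto simp flip: keys_eq_empty)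
  then have "i \<in> Poly_Mapping.keys (c + d)" by (simp add: in_keys_iff lookup_add)
  then have "weight c * weight d \<le> n * nth_prime i"
    using assms(1) by (auto simp: min_gens_def weight_add)
  also have "\<dots> \<le> n * weight d" using nth_prime_le_weight[OF i] by simp
  finally show False using assms(2) weight_pos[of d] by simp
qed

lemma minimal_mono_gens_weight_ideal:
  "minimal_mono_gens (prime_pi n) (weight_ideal n :: 'k::field mpoly set) = min_gens (prime_pi n) n"
proof -
  let ?r = "prime_pi n"
  let ?A = "{a \<in> monomials ?r. weight a > n}"
  let ?M = "min_gens ?r n"
  have sub: "?M \<subseteq> ?A" by (auto simp: min_gens_def)
  have up: "multiples ?r C \<subseteq> ?A" if C: "C \<subseteq> ?A" for C
  proof
    fix c assume "c \<in> multiples ?r C"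
    then obtain a b where ab: "c = a + b" "a \<in> C" "b \<in> monomials ?r" by (auto simp: multiples_def)
    then have "n < weight a" "a \<in> monomials ?r" using C by auto
    moreover have "weight a \<le> weight c" using weight_pos[of b] by (simp add: ab(1) weight_add)
    ultimately show "c \<in> ?A" using ab monomials_add by auto
  qed
  have A: "multiples ?r ?A = ?A" by (intro equalityI up subset_refl subsetI multiples_self)
  have M: "multiples ?r ?M = ?A" by (intro equalityI up sub subsetI) (simp add: multiples_min_gens)
  \<comment> \<open>A generator \<open>m\<close> outside \<open>C\<close> would be a multiple of
    some \<open>c\<close> in \<open>C\<close>. As \<open>c\<close> has weight above
    \<open>n\<close>, it cannot divide \<open>m\<close> properly, so \<open>m = c\<close>.\<close>
  have strict: "multiples ?r C \<noteq> ?A" if C: "C \<subset> ?M" for C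
  proof
    assume eq: "multiples ?r C = ?A"
    obtain m where m: "m \<in> ?M" "m \<notin> C" using C by blast
    then have "m \<in> multiples ?r C" using sub eq by blast
    then obtain c d where cd: "m = c + d" "c \<in> C" by (auto simp: multiples_def)
    then have "d = 0" using m C sub by (intro min_gens_dvd[of c d]) auto
    then show False using cd m by simp
  qed
  have "is_minimal_mono_gens ?r (weight_ideal n :: 'k mpoly set) ?M"
    unfolding is_minimal_mono_gens_def weight_ideal_def
  proof (intro conjI allI impI)
    show "?M \<subseteq> monomials ?r" using sub by blast
    have "?M \<subseteq> monomials ?r" "?A \<subseteq> monomials ?r" using sub by blast+
    then show "(mono_ideal ?r ?M :: 'k mpoly set) = mono_ideal ?r ?A"
      by (simp only: mono_ideal_eq_iff A M)
  next
    fix C assume C: "C \<subset> ?M"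
    then have "C \<subseteq> monomials ?r" "?A \<subseteq> monomials ?r" using sub by blast+
    then show "(mono_ideal ?r C :: 'k mpoly set) \<noteq> mono_ideal ?r ?A"
      by (simp only: mono_ideal_eq_iff A strict[OF C] not_False_eq_True)
  qed
  moreover have ex1: "\<exists>!B. is_minimal_mono_gens ?r (weight_ideal n :: 'k mpoly set) B"
    unfolding weight_ideal_def by (rule ex1_minimal_mono_gens) auto
  ultimately show ?thesis
    unfolding minimal_mono_gens_def by (intro the1_equality[OF ex1])
qed

section \<open>Generators with support of size two\<close>

definition two_var :: "nat \<Rightarrow> nat \<Rightarrow> nat \<Rightarrow> nat \<Rightarrow> monomial" where
  "two_var i a j b = Poly_Mapping.single i a + Poly_Mapping.single j b"

lemma lookup_two_var:
  "i \<noteq> j \<Longrightarrow> Poly_Mapping.lookup (two_var i a j b) k = (if k = i then a else if k = j then b else 0)"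
  by (auto simp: two_var_def lookup_add lookup_single when_def)

lemma keys_two_var: "i \<noteq> j \<Longrightarrow> 0 < a \<Longrightarrow> 0 < b \<Longrightarrow> Poly_Mapping.keys (two_var i a j b) = {i, j}"
  by (auto simp: in_keys_iff lookup_two_var split: if_splits)

lemma weight_two_var: "weight (two_var i a j b) = nth_prime i ^ a * nth_prime j ^ b"
  by (simp add: two_var_def weight_add weight_single)

lemma two_var_cases:
  assumes "card (Poly_Mapping.keys m) = 2"
  obtains i j a b where "i < j" "0 < a" "0 < b" "m = two_var i a j b"
proof -
  obtain i j where ij: "Poly_Mapping.keys m = {i, j}" "i < j"
    using assms unfolding card_2_iff by (metis insert_commute linorder_neqE_nat)
  have "m = two_var i (Poly_Mapping.lookup m i) j (Poly_Mapping.lookup m j)"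
    using ij by (intro poly_mapping_eqI) (auto simp: lookup_two_var simp flip: not_in_keys_iff_lookup_eq_zero)
  moreover have "0 < Poly_Mapping.lookup m i" "0 < Poly_Mapping.lookup m j"
    using ij(1) in_keys_iff[of _ m] by auto
  ultimately show ?thesis using ij(2) that by blast
qed

text \<open>The condition at \<open>j\<close> is implied by the one at \<open>i\<close>, since \<open>p\<^sub>i < p\<^sub>j\<close>.\<close>
lemma two_var_in_min_gens:
  assumes "i < j" "0 < a" "0 < b"
  shows "two_var i a j b \<in> min_gens r n \<longleftrightarrow>
    1 \<le> i \<and> j \<le> r \<and> n < nth_prime i ^ a * nth_prime j ^ b \<and>
    nth_prime i ^ (a - 1) * nth_prime j ^ b \<le> n"
proof -
  let ?w = "nth_prime i ^ a * nth_prime j ^ b"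
  have "?w = nth_prime i ^ (a - 1) * nth_prime j ^ b * nth_prime i"
    using assms(2) by (cases a) (auto simp: algebra_simps)
  then have *: "?w \<le> n * nth_prime i \<longleftrightarrow> nth_prime i ^ (a - 1) * nth_prime j ^ b \<le> n"
    using nth_prime_gt_1[of i] by (simp only: mult_le_cancel2) simp
  have "?w \<le> n * nth_prime j" if "1 \<le> i" "?w \<le> n * nth_prime i"
    using that nth_prime_strict_mono[of i j] assms(1)
    by (meson le_trans less_imp_le mult_le_mono2)
  then show ?thesis
    using assms unfolding *[symmetric]
    by (auto simp: min_gens_def monomials_def keys_two_var weight_two_var)
qed

text \<open>Here \<open>b\<close> is the exponent of the variable with the larger index
  \<open>j\<close>; the exponent at \<open>i\<close> is determined by the triple and not
  recorded.\<close>

definition power_triples :: "nat \<Rightarrow> nat \<Rightarrow> (nat \<times> nat \<times> nat) set" where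
  "power_triples r n = {(i, j, b). 1 \<le> i \<and> i < j \<and> j \<le> r \<and> 1 \<le> b \<and> nth_prime j ^ b \<le> n}"

lemma least_exponent_unique:
  fixes p :: nat
  assumes "1 < p" "n < p ^ a * q" "p ^ (a - 1) * q \<le> n" "n < p ^ c * q" "p ^ (c - 1) * q \<le> n"
    "0 < a" "0 < c"
  shows "a = c"
proof -
  \<comment> \<open>Stated for arbitrary exponents, so that exchanging the two gives the reverse
    inequality.\<close>
  have "a \<le> c" if "n < p ^ c * q" "p ^ (a - 1) * q \<le> n" "0 < a" for a c
  proof (rule ccontr)
    assume "\<not> a \<le> c"
    then have "p ^ c \<le> p ^ (a - 1)" using assms(1) by (intro power_increasing) auto
    then have "p ^ c * q \<le> p ^ (a - 1) * q" by simp
    then show False using that by linarith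
  qed
  then show ?thesis using assms by (meson antisym)
qed

text \<open>The least exponent with \<open>n < p ^ a * q\<close> works, since its predecessor fails
  this inequality. It has a predecessor because \<open>q \<le> n\<close> rules out exponent
  0.\<close>

lemma least_exponent_exists:
  fixes p :: nat
  assumes "1 < p" "0 < q" "q \<le> n"
  obtains a where "0 < a" "n < p ^ a * q" "p ^ (a - 1) * q \<le> n"
proof -
  let ?P = "\<lambda>a. n < p ^ a * q"
  \<comment> \<open>The exponent \<open>n\<close> already exceeds the bound, so a least one
    exists.\<close>
  have "n < p ^ n * 1" using assms(1) by (simp add: power_gt_expt)
  also have "\<dots> \<le> p ^ n * q" using assms(2) by (intro mult_le_mono2) simp
  finally have L: "?P (LEAST a. ?P a)" by (rule LeastI[of ?P])
  let ?a = "LEAST a. ?P a"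
  have pos: "0 < ?a" using L assms(3) by (intro gr0I) auto
  then have "\<not> ?P (?a - 1)" by (intro not_less_Least) auto
  then show ?thesis using that[of ?a] L pos by simp
qed

text \<open>The map forgets the exponent of the smaller variable. Uniqueness of the least exponent
  makes it injective, existence makes it surjective.\<close>

lemma bij_betw_power_triples:
  "bij_betw (\<lambda>m. (Min (Poly_Mapping.keys m), Max (Poly_Mapping.keys m),
                   Poly_Mapping.lookup m (Max (Poly_Mapping.keys m))))
     {m \<in> min_gens r n. card (Poly_Mapping.keys m) = 2} (power_triples r n)"
    (is "bij_betw ?f ?T _")
proof -
  have f: "?f (two_var i a j b) = (i, j, b)" if "i < j" "0 < a" "0 < b" for i a j b
    using that by (simp add: keys_two_var lookup_two_var)
  show ?thesis
  proof (rule bij_betw_imageI)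
    show "inj_on ?f ?T"
    proof (rule inj_onI)
      fix m m' assume m: "m \<in> ?T" "m' \<in> ?T" "?f m = ?f m'"
      obtain i j a b where 1: "i < j" "0 < a" "0 < b" "m = two_var i a j b"
        using m(1) by (auto elim: two_var_cases)
      obtain i' j' a' b' where 2: "i' < j'" "0 < a'" "0 < b'" "m' = two_var i' a' j' b'"
        using m(2) by (auto elim: two_var_cases)
      have eq: "i' = i" "j' = j" "b' = b" using m(3) unfolding 1(4) 2(4) by (simp_all only: f 1 2 prod.inject)
      have "a = a'"
        using m(1,2) 1 2 nth_prime_gt_1[of i]
        by (intro least_exponent_unique[of "nth_prime i" n a "nth_prime j ^ b"]) (auto simp: eq two_var_in_min_gens)
      then show "m = m'" by (simp add: 1(4) 2(4) eq)
    qed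
    show "?f ` ?T = power_triples r n"
    proof (intro equalityI subsetI)
      fix t assume "t \<in> ?f ` ?T"
      then obtain m where m: "m \<in> ?T" "t = ?f m" by blast
      obtain i j a b where 1: "i < j" "0 < a" "0 < b" "m = two_var i a j b"
        using m(1) by (auto elim: two_var_cases)
      have w: "1 \<le> i" "j \<le> r" "nth_prime i ^ (a - 1) * nth_prime j ^ b \<le> n"
        using m(1) 1 by (auto simp: two_var_in_min_gens)
      have "1 \<le> nth_prime i ^ (a - 1)" using nth_prime_gt_1[of i] by (intro one_le_power) simp
      then have "1 * nth_prime j ^ b \<le> nth_prime i ^ (a - 1) * nth_prime j ^ b" by (rule mult_le_mono1)
      then have "nth_prime j ^ b \<le> n" using w(3) by linarith
      then show "t \<in> power_triples r n"
        unfolding m(2) 1(4) f[OF 1(1-3)] using w 1 by (simp add: power_triples_def)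
    next
      fix t assume "t \<in> power_triples r n"
      then obtain i j b where t: "t = (i, j, b)" "1 \<le> i" "i < j" "j \<le> r" "1 \<le> b" "nth_prime j ^ b \<le> n"
        by (auto simp: power_triples_def)
      have "0 < nth_prime j ^ b" using nth_prime_gt_1[of j] by simp
      then obtain a where a: "0 < a" "n < nth_prime i ^ a * nth_prime j ^ b"
          "nth_prime i ^ (a - 1) * nth_prime j ^ b \<le> n"
        using nth_prime_gt_1 t(6) by (metis least_exponent_exists)
      have "two_var i a j b \<in> ?T"
        using t a by (simp add: two_var_in_min_gens keys_two_var)
      moreover have "t = ?f (two_var i a j b)" using t a by (subst f) auto
      ultimately show "t \<in> ?f ` ?T" by blast
    qed
  qed
qed

section \<open>Counting the triples\<close>

lemma finite_power_triples: "finite (power_triples r n)"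
proof (rule finite_subset)
  show "power_triples r n \<subseteq> {..r} \<times> {..r} \<times> {..n}"
  proof (clarsimp simp: power_triples_def)
    fix j b assume "nth_prime j ^ b \<le> n"
    moreover have "b < nth_prime j ^ b" using nth_prime_gt_1[of j] by (intro power_gt_expt) simp
    ultimately show "b \<le> n" by simp
  qed
qed simp

text \<open>Pairs are grouped by their larger index \<open>j\<close>, which leaves
  \<open>j - 1\<close> choices for the smaller one.\<close>

lemma card_pairs_eq_choose_2: "card (SIGMA j:{1..r}. {1..<j}) = r choose 2"
proof -
  have "card (SIGMA j:{1..r}. {1..<j}) = (\<Sum>j\<in>{1..r}. j - 1)" by simp
  also have "\<dots> = r choose 2" by (induction r) (auto simp: numeral_2_eq_2)
  finally show ?thesis .
qed

theorem proposition9: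
  fixes n :: nat
  assumes "n \<ge> 2"
  defines "N \<equiv> card {m \<in> minimal_mono_gens (prime_pi n) (weight_ideal n :: 'k::field_char_0 mpoly set).
                       card (Poly_Mapping.keys m) = 2}"
  shows "N \<ge> prime_pi n choose 2 \<and> (N = prime_pi n choose 2 \<longleftrightarrow> n \<le> 8)"
proof -
  let ?r = "prime_pi n"
  let ?T = "power_triples ?r n"
  let ?P = "(\<lambda>(j, i). (i, j, 1 :: nat)) ` (SIGMA j:{1..?r}. {1..<j})"
  have N: "N = card ?T"
    unfolding N_def minimal_mono_gens_weight_ideal by (rule bij_betw_same_card[OF bij_betw_power_triples])
  have P: "card ?P = ?r choose 2"
    by (subst card_image) (auto simp: inj_on_def card_pairs_eq_choose_2[unfolded One_nat_def] simp del: card_SigmaI)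
  have sub: "?P \<subseteq> ?T" by (auto simp: power_triples_def nth_prime_le)
  have eq: "?P = ?T" if "n \<le> 8"
  proof (intro equalityI sub subsetI)
    fix t assume "t \<in> ?T"
    then obtain i j b where t: "t = (i, j, b)" "1 \<le> i" "i < j" "j \<le> ?r" "1 \<le> b" "nth_prime j ^ b \<le> n"
      by (auto simp: power_triples_def)
    \<comment> \<open>From \<open>1 \<le> i < j\<close> follows \<open>j \<ge> 2\<close>, so the
      prime at \<open>j\<close> is at least 3 and its square at least 9, which exceeds
      \<open>n\<close>.\<close>
    have "b = 1"
    proof (rule ccontr)
      assume "b \<noteq> 1"
      then have "nth_prime j ^ 2 \<le> nth_prime j ^ b"
        using t nth_prime_gt_1[of j] by (intro power_increasing) auto
      moreover have "3 ^ 2 \<le> nth_prime j ^ 2" using t by (intro power_mono nth_prime_ge_3) auto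
      ultimately show False using t(6) that by simp
    qed
    then show "t \<in> ?P" using t by force
  qed
  have neq: "?P \<noteq> ?T" if "\<not> n \<le> 8"
  proof -
    have "{2, 3} \<subseteq> {p. prime p \<and> p \<le> n}" using that by auto
    then have "card {2 :: nat, 3} \<le> ?r" unfolding prime_pi_def by (intro card_mono) auto
    \<comment> \<open>This triple stands for the power \<open>3 ^ 2 = 9 \<le> n\<close>; the index 2
      is admissible because 2 and 3 are primes up to \<open>n\<close>.\<close>
    then have "(1, 2, 2) \<in> ?T" using that by (simp add: power_triples_def nth_prime_2)
    moreover have "(1, 2, 2) \<notin> ?P" by auto
    ultimately show ?thesis by metis
  qed
  \<comment> \<open>For a subset of a finite set, equal cardinality means equality.\<close>
  have "card ?P = card ?T \<longleftrightarrow> ?P = ?T"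
    using card_subset_eq[OF finite_power_triples sub] by (intro iffI) simp_all
  also have "\<dots> \<longleftrightarrow> n \<le> 8"
    using eq neq by (intro iffI) (rule ccontr, simp)
  finally have "N = ?r choose 2 \<longleftrightarrow> n \<le> 8"
    unfolding N P by (simp only: eq_commute)
  moreover have "?r choose 2 \<le> N"
    using card_mono[OF finite_power_triples sub] unfolding N P .
  ultimately show ?thesis by blast
qed

end
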